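(* Let $N\ge 7$ be an odd integer and let $\ell$ be an integer with $1\le \ell\le \frac N2-1$. Then the average hitting time from vertex $0$ to vertex $\ell$ of the simple random walk on $G_N^{(2)}$ is \[ h(0,\ell)=\frac{2N(N-5)}{\sqrt{4N-25}}\,\Im\left(C_N-\frac{C_N}{2}\mathcal P_\ell^{(2)}-\frac12\mathcal B_\ell^{(2)}\right), \] where $\Im$ denotes the imaginary part and \[ C_N:=\frac{2+\mathcal P_N^{(2)}+d\,\mathcal B_N^{(2)}}{d\left(2-\mathcal P_N^{(2)}-d\,\mathcal B_N^{(2)}\right)}. \]
   Context: For odd $N$, the graph $G_N^{(2)}$ has vertex set $\mathbb Z/N\mathbb Z$; two distinct vertices $x,y$ are adjacent iff their circular distance $\min\{|x-y|,N-|x-y|\}$ (with representatives in $\{0,\dots,N-1\}$) is at least $3$. The simple random walk moves at each step from the current vertex to a uniformly random neighbor; $h(x,y)=\mathbb E_x[T_y]$, where $T_y$ is the hitting time of $y$ and the walk starts at $x$. Set $\tau:=\frac{-1+i\sqrt{4N-25}}{2}$, let $\rho\in\mathbb C$ be the solution of $\rho+\rho^{-1}=\tau$ with $|\rho|<1$, and let $d:=\rho-\rho^{-1}$. For $k\ge0$, $\mathcal P_k^{(2)}:=\rho^k+\rho^{-k}$ and $\mathcal B_k^{(2)}:=\frac{\rho^k-\rho^{-k}}{d}$. *)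

theory Defs
  imports "HOL-Probability.Probability"
begin

section \<open>Simple random walk on a graph\<close>

text \<open>
  A graph is given by its adjacency relation on a countable type. Every vertex that the
  walk can reach is assumed to have a finite, nonempty neighbourhood (otherwise
  \<^const>\<open>pmf_of_set\<close> is unspecified).
\<close>

definition srw_step :: "('a \<Rightarrow> 'a \<Rightarrow> bool) \<Rightarrow> 'a \<Rightarrow> 'a pmf" where
  "srw_step E v = pmf_of_set {w. E v w}"

text \<open>Law of the position at time \<open>n\<close> given the positions at the times \<open>0, \<dots>, n - 1\<close>.\<close>

definition srw_kernel :: "('a \<Rightarrow> 'a \<Rightarrow> bool) \<Rightarrow> 'a \<Rightarrow> nat \<Rightarrow> (nat \<Rightarrow> 'a) \<Rightarrow> 'a measure" where
  "srw_kernel E x n \<omega> = measure_pmf (if n = 0 then return_pmf x else srw_step E (\<omega> (n - 1)))"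

lemma Ionescu_Tulcea_srw_kernel:
  fixes x :: "'a :: countable"
  shows "Ionescu_Tulcea (srw_kernel E x) (\<lambda>_. count_space UNIV)"
proof (rule Ionescu_Tulcea.intro)
  fix n :: nat
  show "srw_kernel E x n \<in> PiM {0..<n} (\<lambda>_. count_space UNIV) \<rightarrow>\<^sub>M subprob_algebra (count_space UNIV)"
  proof (cases "n = 0")
    case True
    then have "srw_kernel E x n = (\<lambda>_. measure_pmf (return_pmf x))"
      by (simp add: srw_kernel_def fun_eq_iff)
    then show ?thesis
      by (simp add: measure_pmf_in_subprob_algebra)
  next
    case False
    then have "(\<lambda>\<omega>. \<omega> (n - 1)) \<in> PiM {0..<n} (\<lambda>_. count_space (UNIV :: 'a set)) \<rightarrow>\<^sub>M count_space UNIV"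
      by (intro measurable_component_singleton) auto
    moreover have "(\<lambda>v. measure_pmf (srw_step E v)) \<in> count_space UNIV \<rightarrow>\<^sub>M subprob_algebra (count_space UNIV)"
      by (simp add: measure_pmf_in_subprob_algebra)
    ultimately have "(\<lambda>\<omega>. measure_pmf (srw_step E (\<omega> (n - 1))))
        \<in> PiM {0..<n} (\<lambda>_. count_space UNIV) \<rightarrow>\<^sub>M subprob_algebra (count_space UNIV)"
      by (rule measurable_compose)
    with False show ?thesis
      by (simp add: srw_kernel_def[abs_def])
  qed
qed (simp add: srw_kernel_def prob_space_measure_pmf)

text \<open>
  The law on trajectories of the walk started at \<open>x\<close>: the Ionescu-Tulcea measure of the
  kernels above, with the discrete sigma-algebra on the vertices.
\<close>

definition srw :: "('a :: countable \<Rightarrow> 'a \<Rightarrow> bool) \<Rightarrow> 'a \<Rightarrow> (nat \<Rightarrow> 'a) measure" where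
  "srw E x = projective_family.lim UNIV
     (Ionescu_Tulcea.CI (srw_kernel E x) (\<lambda>_. count_space UNIV)) (\<lambda>_. count_space UNIV)"

lemma sets_srw: "sets (srw E x) = sets (PiM UNIV (\<lambda>_. count_space UNIV))"
proof -
  interpret IT: Ionescu_Tulcea "srw_kernel E x" "\<lambda>_. count_space UNIV"
    by (rule Ionescu_Tulcea_srw_kernel)
  show ?thesis
    unfolding srw_def by (rule IT.PF.sets_lim)
qed

lemma prob_space_srw: "prob_space (srw E x)"
proof -
  interpret IT: Ionescu_Tulcea "srw_kernel E x" "\<lambda>_. count_space UNIV"
    by (rule Ionescu_Tulcea_srw_kernel)
  have "emeasure IT.PF.lim (IT.PF.emb UNIV {} (space (PiM {} (\<lambda>_. count_space UNIV)))) = 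
     emeasure (IT.CI {}) (space (PiM {} (\<lambda>_. count_space UNIV)))"
    by (rule IT.lim) auto
  also have "\<dots> = 1"
    using prob_space.emeasure_space_1[OF IT.PF.prob_space_P[of "{}"]] by (simp add: IT.PF.space_P)
  finally show ?thesis
    unfolding srw_def
    by (intro prob_spaceI) (simp add: space_PiM prod_emb_def vimage_def restrict_def)
qed

lemma emeasure_srw_path:
  fixes x :: "'a :: countable"
  shows "emeasure (srw E x) {\<omega>. \<forall>i\<le>n. \<omega> i = v i} =
    ennreal (indicator {x} (v 0) * (\<Prod>i<n. pmf (srw_step E (v i)) (v (Suc i))))"
proof -
  let ?M = "\<lambda>_::nat. count_space (UNIV :: 'a set)"
  interpret IT: Ionescu_Tulcea "srw_kernel E x" ?M
    by (rule Ionescu_Tulcea_srw_kernel)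
  define c where "c n = {restrict v {0..<n}}" for n
  have c_sets: "c n \<in> sets (PiM {0..<n} ?M)" for n
  proof -
    have "c n = (\<Pi>\<^sub>E i\<in>{0..<n}. {v i})" 
      by (auto simp: c_def PiE_iff fun_eq_iff restrict_def extensional_def)
    also have "\<dots> \<in> sets (PiM {0..<n} ?M)" by (rule sets_PiM_I_finite) auto
    finally show ?thesis .
  qed
  have sp: "(\<lambda>_. undefined) \<in> space (PiM {0..<0} ?M)" by (simp add: space_PiM)
  define q where "q n = (if n = 0 then indicator {x} (v 0)
      else pmf (srw_step E (v (n - 1))) (v n))" for n
  have C: "emeasure (IT.C 0 n (\<lambda>_. undefined)) (c n) = ennreal (\<Prod>i<n. q i)" for n
  proof (induction n)
    case 0
    show ?case by (simp add: c_def restrict_def) (simp add: PiM_empty)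
  next
    case (Suc n)
    let ?C = "IT.C 0 n (\<lambda>_. undefined)"
    have "emeasure (IT.C 0 (Suc n) (\<lambda>_. undefined)) (c (Suc n))
       = (\<integral>\<^sup>+\<omega>. emeasure (IT.eP n \<omega>) (c (Suc n)) \<partial>?C)"
      using c_sets[of "Suc n"] IT.space_C[OF sp, of n]
      by (simp, subst emeasure_bind[where N="PiM {0..<Suc n} ?M"])
         (auto simp: space_PiM measurable_cong_sets[OF IT.sets_C[OF sp, of n] refl]
           intro: IT.measurable_eP[of n, simplified])
    also have "\<dots> = (\<integral>\<^sup>+\<omega>. ennreal (q n) * indicator (c n) \<omega> \<partial>?C)"
    proof (rule nn_integral_cong)
      fix \<omega> assume "\<omega> \<in> space ?C"
      then have w: "\<omega> \<in> space (PiM {0..<n} ?M)" using IT.space_C[OF sp, of n] by simp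
      have ext: "\<omega> i = undefined" if "i \<ge> n" for i
        using w that by (auto simp: space_PiM PiE_def extensional_def)
      have "emeasure (IT.eP n \<omega>) (c (Suc n)) =
          emeasure (srw_kernel E x n \<omega>) (fun_upd \<omega> n -` c (Suc n))"
        using IT.emeasure_eP[OF w c_sets[of "Suc n"]] by simp
      also have "fun_upd \<omega> n -` c (Suc n) = (if \<omega> \<in> c n then {v n} else {})"
      proof -
        have "fun_upd \<omega> n y = restrict v {0..<Suc n} \<longleftrightarrow> \<omega> = restrict v {0..<n} \<and> y = v n" for y
          using ext by (force simp: fun_eq_iff restrict_def less_Suc_eq not_less split: if_splits)
        then show ?thesis by (auto simp: c_def)
      qed
      also have "emeasure (srw_kernel E x n \<omega>) \<dots> = ennreal (q n) * indicator (c n) \<omega>"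
      proof (cases "\<omega> \<in> c n")
        case True
        then have "\<omega> (n - 1) = v (n - 1)" if "n \<noteq> 0" using that by (simp add: c_def)
        with True show ?thesis
          by (auto simp: srw_kernel_def q_def emeasure_pmf_single indicator_def)
      qed simp
      finally show "emeasure (IT.eP n \<omega>) (c (Suc n)) = ennreal (q n) * indicator (c n) \<omega>" .
    qed
    also have "\<dots> = ennreal (q n) * emeasure ?C (c n)"
      using c_sets[of n] IT.sets_C[OF sp, of n] by (subst nn_integral_cmult_indicator) auto
    also have "\<dots> = ennreal (\<Prod>i<Suc n. q i)"
      by (simp add: Suc.IH, subst ennreal_mult[symmetric])
         (auto simp: q_def mult.commute intro!: prod_nonneg)
    finally show ?case .
  qed
  have "restrict \<omega> {0..<Suc n} = restrict v {0..<Suc n} \<longleftrightarrow> (\<forall>i\<le>n. \<omega> i = v i)" for \<omega>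
    unfolding restrict_def fun_eq_iff by (simp add: less_Suc_eq_le)
  then have "{\<omega>. \<forall>i\<le>n. \<omega> i = v i} = IT.PF.emb UNIV {0..<Suc n} (c (Suc n))"
    by (simp add: prod_emb_def c_def space_PiM vimage_def)
  then have "emeasure (srw E x) {\<omega>. \<forall>i\<le>n. \<omega> i = v i} = emeasure (IT.CI {0..<Suc n}) (c (Suc n))"
    unfolding srw_def using IT.lim[OF _ c_sets[of "Suc n"]] by simp
  also have "\<dots> = emeasure (IT.C 0 (Suc n) (\<lambda>_. undefined)) (c (Suc n))"
    using IT.emeasure_CI[OF order_refl c_sets[of "Suc n"]] c_sets[of "Suc n", THEN sets.sets_into_space]
    by (simp add: prod_emb_id space_PiM)
  also have "\<dots> = ennreal (\<Prod>i<Suc n. q i)"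
    by (rule C)
  also have "(\<Prod>i<Suc n. q i) = indicator {x} (v 0) * (\<Prod>i<n. pmf (srw_step E (v i)) (v (Suc i)))"
    by (subst prod.lessThan_Suc_shift) (simp add: q_def)
  finally show ?thesis .
qed

text \<open>The infimum of the empty set is \<open>\<infinity>\<close>: a trajectory that misses \<open>y\<close> has infinite hitting time.\<close>

definition hitting_time :: "'a \<Rightarrow> (nat \<Rightarrow> 'a) \<Rightarrow> enat" where
  "hitting_time y \<omega> = (INF n\<in>{n. \<omega> n = y}. enat n)"

definition avg_hitting_time :: "('a :: countable \<Rightarrow> 'a \<Rightarrow> bool) \<Rightarrow> 'a \<Rightarrow> 'a \<Rightarrow> ennreal" where
  "avg_hitting_time E x y = (\<integral>\<^sup>+\<omega>. ennreal_of_enat (hitting_time y \<omega>) \<partial>srw E x)"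

lemma measurable_hitting_time:
  "(\<lambda>\<omega>. ennreal_of_enat (hitting_time y \<omega>)) \<in> borel_measurable (srw E x)"
proof -
  have "hitting_time y \<omega> = (INF n. if \<omega> n = y then enat n else \<infinity>)" for \<omega> :: "nat \<Rightarrow> 'a"
    unfolding hitting_time_def
  proof (intro antisym INF_greatest)
    fix n assume "n \<in> {n. \<omega> n = y}"
    then show "(INF n. if \<omega> n = y then enat n else \<infinity>) \<le> enat n"
      by (intro INF_lower2[of n]) auto
  qed (auto intro: INF_lower)
  moreover have "(\<lambda>\<omega>. INF n. if \<omega> n = y then enat n else \<infinity>) \<in>
      PiM UNIV (\<lambda>_. count_space UNIV) \<rightarrow>\<^sub>M count_space UNIV"
    by measurable
  ultimately show ?thesis
    by (simp add: measurable_cong_sets[OF sets_srw refl] measurable_compose[where N="count_space UNIV"])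
qed


section \<open>The graph on residues at circular distance at least 3\<close>

text \<open>The vertex set of residues mod \<open>N\<close> is represented by \<open>{0, \<dots>, N - 1}\<close>.\<close>

definition circ_dist :: "nat \<Rightarrow> nat \<Rightarrow> nat \<Rightarrow> int" where
  "circ_dist N x y = min \<bar>int x - int y\<bar> (int N - \<bar>int x - int y\<bar>)"

definition G2 :: "nat \<Rightarrow> nat \<Rightarrow> nat \<Rightarrow> bool" where
  "G2 N x y \<longleftrightarrow> x < N \<and> y < N \<and> x \<noteq> y \<and> circ_dist N x y \<ge> 3"

lemma G2_neighbours:
  assumes "N \<ge> 7" and "x < N"
  shows "finite {y. G2 N x y}" and "{y. G2 N x y} \<noteq> {}"
proof -
  show "finite {y. G2 N x y}"
    by (rule finite_subset[of _ "{..<N}"]) (auto simp: G2_def)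
  have "G2 N x (if x + 3 < N then x + 3 else x + 3 - N)"
    using assms by (auto simp: G2_def circ_dist_def)
  then show "{y. G2 N x y} \<noteq> {}" by blast
qed


section \<open>The parameters of the formula\<close>

definition tau :: "nat \<Rightarrow> complex" where
  "tau N = (- 1 + \<i> * of_real (sqrt (4 * real N - 25))) / 2"

definition rho :: "nat \<Rightarrow> complex" where
  "rho N = (THE r. r + inverse r = tau N \<and> norm r < 1)"

lemma rho_unique:
  assumes "N \<ge> 7"
  shows "\<exists>!r. r + inverse r = tau N \<and> norm r < 1"
proof -
  define s where "s = csqrt ((tau N)\<^sup>2 - 4)"
  define r1 where "r1 = (tau N + s) / 2"
  define r2 where "r2 = (tau N - s) / 2"
  have im: "Im (tau N) > 0"
    using assms by (simp add: tau_def)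
  have s2: "s\<^sup>2 = (tau N)\<^sup>2 - 4" by (simp add: s_def)
  have prod: "r1 * r2 = 1" and sum: "r1 + r2 = tau N"
    using s2 by (simp_all add: r1_def r2_def field_simps power2_eq_square)
  have inv: "r2 = inverse r1" "r1 = inverse r2"
    using prod by (metis inverse_unique, metis inverse_unique mult.commute)
  have nrm: "norm r1 * norm r2 = 1"
    using prod by (metis norm_mult norm_one)
  have ne: "norm r1 \<noteq> 1"
  proof
    assume n: "norm r1 = 1"
    then have "r1 * cnj r1 = 1"
      using complex_norm_square[of r1] by simp
    then have "cnj r1 = r2" using inv(1) by (metis inverse_unique)
    then have "tau N = r1 + cnj r1" using sum by simp
    then show False using im by (simp add: complex_add_cnj)
  qed
  have roots: "r = r1 \<or> r = r2" if "r + inverse r = tau N" for r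
  proof -
    have "r \<noteq> 0" using that im by auto
    then have "(r - r1) * (r - r2) = r * (r + inverse r - (r1 + r2)) + (r1 * r2 - 1)"
      by (simp add: field_simps)
    then have "(r - r1) * (r - r2) = 0" using that prod sum by simp
    then show ?thesis by simp
  qed
  have ok: "r1 + inverse r1 = tau N" "r2 + inverse r2 = tau N"
    using sum inv by (metis, metis add.commute)
  have "norm r1 < 1 \<longleftrightarrow> \<not> norm r2 < 1"
  proof
    assume 1: "norm r1 < 1"
    show "\<not> norm r2 < 1"
    proof
      assume "norm r2 < 1"
      then have "norm r1 * norm r2 \<le> norm r1"
        by (intro mult_left_le) auto
      with 1 nrm show False by simp
    qed
  next
    assume "\<not> norm r2 < 1"
    then have "norm r1 * 1 \<le> norm r1 * norm r2"
      by (intro mult_left_mono) auto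
    with nrm ne show "norm r1 < 1" by simp
  qed
  then show ?thesis using roots ok by metis
qed

definition dd :: "nat \<Rightarrow> complex" where
  "dd N = rho N - inverse (rho N)"

definition P2 :: "nat \<Rightarrow> nat \<Rightarrow> complex" where
  "P2 N k = rho N ^ k + inverse (rho N) ^ k"

definition B2 :: "nat \<Rightarrow> nat \<Rightarrow> complex" where
  "B2 N k = (rho N ^ k - inverse (rho N) ^ k) / dd N"

definition CC :: "nat \<Rightarrow> complex" where
  "CC N = (2 + P2 N N + dd N * B2 N N) / (dd N * (2 - P2 N N - dd N * B2 N N))"

end

theory Submission
  imports Defs
begin

text \<open>
  If \<open>g\<close> vanishes at the target and satisfies the first-step equations \<open>g = 1 + P g\<close> elsewhere, then
  \<open>g (X\<^sub>n) + n\<close>, stopped at \<open>T\<close>, is a martingale; on a finite vertex set this gives the finiteness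
  of \<open>E T\<close> and \<open>E T = g x\<close> without any discussion of connectivity. On the circulant graph the
  first-step equations form a five-point recurrence with characteristic equation
  \<open>w\<^sup>2 + w + N - 6 = 0\<close> in \<open>w = z + 1 / z\<close>. Its roots are \<open>\<tau>\<close> and the conjugate of \<open>\<tau>\<close>, so the periodic
  Green function of \<open>z + 1 / z - \<tau>\<close>, which is a multiple of \<open>\<rho>\<^sup>k + \<rho>\<^bsup>N - k\<^esup>\<close> for \<open>0 \<le> k \<le> N\<close>, has an
  imaginary part that solves the recurrence. Since \<open>P\<^sub>N + d B\<^sub>N = 2 \<rho>\<^sup>N\<close>, the stated formula is
  this solution, shifted to vanish at the target.
\<close>

section \<open>The Markov property of the trajectory measure\<close>

lemma space_srw [simp]: "space (srw E x) = UNIV"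
  using sets_eq_imp_space_eq[OF sets_srw[of E x]] by (simp add: space_PiM)

lemma measurable_srw_coordinate [measurable]: "(\<lambda>\<omega>. \<omega> i) \<in> srw E x \<rightarrow>\<^sub>M count_space UNIV"
  unfolding measurable_cong_sets[OF sets_srw refl] by measurable

text \<open>The Markov property, for an arbitrary event \<open>S\<close> of the past up to time
  \<open>n\<close>. As the vertex type is countable, there are only countably many pasts, so the
  event splits into countably many cylinders. On each of them \<open>emeasure_srw_path\<close> gains
  exactly one factor when the path is prolonged by \<open>z\<close>, and that factor depends on the
  past only through \<open>w\<close>.\<close>

lemma emeasure_srw_Suc:
  fixes x :: "'a :: countable"
  shows "emeasure (srw E x) {\<omega>. restrict \<omega> {..n} \<in> S \<and> \<omega> n = w \<and> \<omega> (Suc n) = z} =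
    emeasure (srw E x) {\<omega>. restrict \<omega> {..n} \<in> S \<and> \<omega> n = w} * ennreal (pmf (srw_step E w) z)"
proof -
  define B where "B = {v \<in> {..n} \<rightarrow>\<^sub>E (UNIV :: 'a set). v \<in> S \<and> v n = w}"
  have "countable ({..n} \<rightarrow>\<^sub>E (UNIV :: 'a set))"
    by (rule countable_PiE) auto
  then have cB: "countable B"
    by (rule countable_subset[rotated]) (auto simp: B_def)
  have B: "restrict \<omega> {..n} \<in> B \<longleftrightarrow> restrict \<omega> {..n} \<in> S \<and> \<omega> n = w" for \<omega>
    by (simp add: B_def)
  define C where "C v = {\<omega> :: nat \<Rightarrow> 'a. restrict \<omega> {..n} = v}" for v
  define C' where "C' v = {\<omega> :: nat \<Rightarrow> 'a. restrict \<omega> {..n} = v \<and> \<omega> (Suc n) = z}" for v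
  have cyl: "{\<omega>. \<forall>i\<le>m. \<omega> i = v i} \<in> sets (srw E x)" for v :: "nat \<Rightarrow> 'a" and m
  proof -
    have "{\<omega> \<in> space (srw E x). \<forall>i\<le>m. \<omega> i = v i} \<in> sets (srw E x)"
      by measurable
    then show ?thesis by simp
  qed
  have C_eq: "C v = {\<omega>. \<forall>i\<le>n. \<omega> i = v i}" if "v \<in> B" for v
  proof -
    have "restrict v {..n} = v"
      using that by (simp add: B_def PiE_def extensional_restrict)
    then show ?thesis
      unfolding C_def by (auto simp: fun_eq_iff restrict_def split: if_splits)
  qed
  \<comment> \<open>\<open>v\<close> is extensional on \<open>{..n}\<close>, so its value at
    \<open>Suc n\<close> is \<open>undefined\<close>; it has to be overwritten by \<open>z\<close>
    before \<open>v\<close> describes the longer path.\<close>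
  have C'_eq: "C' v = {\<omega>. \<forall>i\<le>Suc n. \<omega> i = (v(Suc n := z)) i}" if "v \<in> B" for v
  proof -
    have "C' v = C v \<inter> {\<omega>. \<omega> (Suc n) = z}"
      by (auto simp: C_def C'_def)
    then show ?thesis
      unfolding C_eq[OF that] by (auto simp: le_Suc_eq)
  qed
  have "{\<omega>. restrict \<omega> {..n} \<in> S \<and> \<omega> n = w} = (\<Union>v\<in>B. C v)"
    by (simp add: C_def B[symmetric] set_eq_iff)
  also have "emeasure (srw E x) \<dots> = (\<integral>\<^sup>+v. emeasure (srw E x) (C v) \<partial>count_space B)"
  proof (rule emeasure_UN_countable[OF _ cB])
    show "disjoint_family_on C B"
      by (auto simp: disjoint_family_on_def C_def)
  qed (simp add: C_eq cyl)
  finally have 1: "emeasure (srw E x) {\<omega>. restrict \<omega> {..n} \<in> S \<and> \<omega> n = w} = \<dots>" .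
  have "{\<omega>. restrict \<omega> {..n} \<in> S \<and> \<omega> n = w \<and> \<omega> (Suc n) = z} = (\<Union>v\<in>B. C' v)"
    using B by (simp add: C'_def set_eq_iff conj_assoc)
  also have "emeasure (srw E x) \<dots> = (\<integral>\<^sup>+v. emeasure (srw E x) (C' v) \<partial>count_space B)"
  proof (rule emeasure_UN_countable[OF _ cB])
    show "disjoint_family_on C' B"
      by (auto simp: disjoint_family_on_def C'_def)
  qed (simp only: C'_eq cyl)
  also have "\<dots> = (\<integral>\<^sup>+v. emeasure (srw E x) (C v) * ennreal (pmf (srw_step E w) z) \<partial>count_space B)"
  proof (rule nn_integral_cong)
    fix v assume "v \<in> space (count_space B)"
    then have v: "v \<in> B" "v n = w" by (simp_all add: B_def)
    have "(\<Prod>i<n. pmf (srw_step E ((v(Suc n := z)) i)) ((v(Suc n := z)) (Suc i))) =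
        (\<Prod>i<n. pmf (srw_step E (v i)) (v (Suc i)))"
      by (intro prod.cong) auto
    then show "emeasure (srw E x) (C' v) = emeasure (srw E x) (C v) * ennreal (pmf (srw_step E w) z)"
      unfolding C_eq[OF v(1)] C'_eq[OF v(1)] emeasure_srw_path
      using v(2) by (simp add: ennreal_mult[symmetric] prod_nonneg mult.assoc)
  qed
  also have "\<dots> = emeasure (srw E x) {\<omega>. restrict \<omega> {..n} \<in> S \<and> \<omega> n = w} *
      ennreal (pmf (srw_step E w) z)"
    unfolding 1 by (rule nn_integral_multc) simp
  finally show ?thesis .
qed

section \<open>Expected hitting times from the first-step equations\<close>

lemma less_hitting_time_iff: "enat n < hitting_time y \<omega> \<longleftrightarrow> (\<forall>i\<le>n. \<omega> i \<noteq> y)"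
proof
  assume "enat n < hitting_time y \<omega>"
  then show "\<forall>i\<le>n. \<omega> i \<noteq> y"
    by (auto simp: hitting_time_def dest!: less_INF_D)
next
  assume "\<forall>i\<le>n. \<omega> i \<noteq> y"
  then have "enat (Suc n) \<le> hitting_time y \<omega>"
    unfolding hitting_time_def by (intro INF_greatest) (auto simp: not_less_eq_eq[symmetric])
  then show "enat n < hitting_time y \<omega>"
    by (rule less_le_trans[rotated]) simp
qed

text \<open>The tail-sum formula \<open>nn_integral_enat_function\<close> asks for measurability as
  an \<open>enat\<close>-valued map, before the embedding into \<open>ennreal\<close>. Filling in
  \<open>\<infinity>\<close> at the times when the walk is not at \<open>y\<close> makes the index
  set of the infimum independent of the trajectory.\<close>

lemma measurable_hitting_time_count_space [measurable]:
  "hitting_time y \<in> srw E x \<rightarrow>\<^sub>M count_space UNIV"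
proof -
  have "(\<lambda>\<omega>. INF n. if \<omega> n = y then enat n else \<infinity>) \<in> srw E x \<rightarrow>\<^sub>M count_space UNIV"
    by measurable
  moreover have "hitting_time y = (\<lambda>\<omega>. INF n. if \<omega> n = y then enat n else \<infinity>)"
  proof
    fix \<omega> :: "nat \<Rightarrow> 'a"
    show "hitting_time y \<omega> = (INF n. if \<omega> n = y then enat n else \<infinity>)"
      unfolding hitting_time_def
    proof (intro antisym INF_greatest)
      fix n assume "n \<in> {n. \<omega> n = y}"
      then show "(INF n. if \<omega> n = y then enat n else \<infinity>) \<le> enat n"
        by (intro INF_lower2[of n]) auto
    qed (auto intro: INF_lower)
  qed
  ultimately show ?thesis by simp
qed

text \<open>Telescoping \<open>\<Phi> (Suc n) = \<Phi> n - Q n\<close> gives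
  \<open>g x - \<Phi> m\<close> for the sum of the \<open>Q n\<close> with \<open>n < m\<close>. The
  bound of \<open>\<Phi>\<close> by \<open>G * Q\<close>, with \<open>Q\<close> at most 1, keeps
  these sums below \<open>g x + G\<close>. Hence \<open>Q\<close> is summable and tends to 0, the
  same bound then forces \<open>\<Phi>\<close> to 0, and the sum of the tail probabilities
  \<open>Q n\<close> is \<open>g x\<close>.\<close>

lemma avg_hitting_time_eqI:
  fixes x y :: "'a :: countable" and g :: "'a \<Rightarrow> real"
  assumes V: "finite V" "x \<in> V" "\<And>v. v \<in> V \<Longrightarrow> set_pmf (srw_step E v) \<subseteq> V"
    and g0: "g y = 0"
    and g: "\<And>v. v \<in> V \<Longrightarrow> v \<noteq> y \<Longrightarrow> g v = 1 + (\<Sum>w\<in>V. pmf (srw_step E v) w * g w)"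
  shows "avg_hitting_time E x y = ennreal (g x)"
proof -
  interpret prob_space "srw E x" by (rule prob_space_srw)
  \<comment> \<open>These events describe the walk killed on reaching \<open>y\<close>; their
    probabilities evolve by the transition matrix with the target removed.\<close>
  define A where "A n w = {\<omega> :: nat \<Rightarrow> 'a. (\<forall>i\<le>n. \<omega> i \<noteq> y) \<and> \<omega> n = w}" for n w
  have A_sets [measurable]: "A n w \<in> sets (srw E x)" for n w
  proof -
    have "{\<omega> \<in> space (srw E x). (\<forall>i\<le>n. \<omega> i \<noteq> y) \<and> \<omega> n = w} \<in> sets (srw E x)"
      by measurable
    then show ?thesis by (simp add: A_def)
  qed
  have A_y: "A n y = {}" for n by (auto simp: A_def)
  \<comment> \<open>The target is excluded because \<open>A (Suc n) y\<close> is empty, although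
    mass may well flow into \<open>y\<close>.\<close>
  have step: "emeasure (srw E x) (A (Suc n) z) =
      (\<integral>\<^sup>+w. emeasure (srw E x) (A n w) * ennreal (pmf (srw_step E w) z) \<partial>count_space UNIV)"
    if "z \<noteq> y" for n z
  proof -
    let ?S = "{v. \<forall>i\<le>n. v i \<noteq> y}"
    let ?A' = "\<lambda>w. {\<omega>. restrict \<omega> {..n} \<in> ?S \<and> \<omega> n = w \<and> \<omega> (Suc n) = z}"
    have "A (Suc n) z = (\<Union>w. ?A' w)"
      using that by (auto simp: A_def le_Suc_eq)
    also have "emeasure (srw E x) \<dots> = (\<integral>\<^sup>+w. emeasure (srw E x) (?A' w) \<partial>count_space UNIV)"
    proof (rule emeasure_UN_countable)
      fix w
      have "{\<omega> \<in> space (srw E x). (\<forall>i\<le>n. \<omega> i \<noteq> y) \<and> \<omega> n = w \<and> \<omega> (Suc n) = z} \<in> sets (srw E x)"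
        by measurable
      then show "?A' w \<in> sets (srw E x)" by simp
    qed (auto simp: disjoint_family_on_def)
    also have "\<dots> = (\<integral>\<^sup>+w. emeasure (srw E x) (A n w) * ennreal (pmf (srw_step E w) z) \<partial>count_space UNIV)"
      unfolding emeasure_srw_Suc by (simp add: A_def)
    finally show ?thesis .
  qed
  have A0: "emeasure (srw E x) (A 0 w) = ennreal (of_bool (w = x \<and> w \<noteq> y))" for w
  proof (cases "w = y")
    case False
    then have "A 0 w = {\<omega>. \<forall>i\<le>0. \<omega> i = (\<lambda>_. w) i}" by (auto simp: A_def)
    then show ?thesis
      using False by (simp add: emeasure_srw_path[of E x 0 "\<lambda>_. w", simplified] indicator_def)
  qed (simp add: A_y)
  \<comment> \<open>Almost surely the walk stays in \<open>V\<close>, so integrals over all vertices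
    become finite sums over \<open>V\<close>.\<close>
  have A_out: "emeasure (srw E x) (A n w) = 0" if "w \<notin> V" for n w
    using that
  proof (induction n arbitrary: w)
    case 0
    then show ?case using V(2) by (auto simp: A0)
  next
    case (Suc n)
    show ?case
    proof (cases "w = y")
      case False
      have zero: "emeasure (srw E x) (A n v) * ennreal (pmf (srw_step E v) w) = 0" for v
      proof (cases "v \<in> V")
        case True
        then show ?thesis using V(3)[of v] Suc.prems by (auto simp: set_pmf_iff)
      qed (simp add: Suc.IH)
      show ?thesis unfolding step[OF False, of n] zero by simp
    qed (simp add: A_y)
  qed
  define a where "a n w = prob (A n w)" for n w
  have a_nonneg: "a n w \<ge> 0" for n w by (simp add: a_def)
  have a_out: "a n w = 0" if "w \<notin> V" for n w
    using A_out[OF that, of n] by (simp add: a_def measure_def)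
  have a_y: "a n y = 0" for n by (simp add: a_def A_y)
  have a_0: "a 0 w = of_bool (w = x \<and> w \<noteq> y)" for w
    using A0[of w] by (simp add: a_def measure_def)
  have a_Suc: "a (Suc n) z = (\<Sum>w\<in>V. a n w * pmf (srw_step E w) z)" if "z \<noteq> y" for n z
  proof -
    have "ennreal (a (Suc n) z) =
        (\<integral>\<^sup>+w. emeasure (srw E x) (A n w) * ennreal (pmf (srw_step E w) z) \<partial>count_space UNIV)"
      using step[OF that, of n] by (simp add: a_def emeasure_eq_measure)
    also have "\<dots> = (\<Sum>w\<in>V. emeasure (srw E x) (A n w) * ennreal (pmf (srw_step E w) z))"
      by (rule nn_integral_count_space') (auto simp: V A_out)
    also have "\<dots> = ennreal (\<Sum>w\<in>V. a n w * pmf (srw_step E w) z)"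
      by (simp add: emeasure_eq_measure ennreal_mult[symmetric] a_def)
    finally show ?thesis
      by (subst (asm) ennreal_inj) (auto intro!: sum_nonneg mult_nonneg_nonneg a_nonneg)
  qed
  define Q where "Q n = (\<Sum>w\<in>V. a n w)" for n
  \<comment> \<open>\<open>Q n\<close> is the probability of \<open>n < T\<close>, and \<open>\<Phi> n\<close> the expectation of \<open>g (X\<^sub>n)\<close> on that event.\<close>
  define \<Phi> where "\<Phi> n = (\<Sum>w\<in>V. a n w * g w)" for n
  have Q_nonneg: "Q n \<ge> 0" for n by (simp add: Q_def sum_nonneg a_nonneg)
  have \<Phi>_0: "\<Phi> 0 = g x"
  proof -
    have "\<Phi> 0 = (\<Sum>w\<in>V. if w = x then g x else 0)"
      unfolding \<Phi>_def by (intro sum.cong) (auto simp: a_0 g0)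
    then show ?thesis using V by simp
  qed
  have \<Phi>_Suc: "\<Phi> (Suc n) = \<Phi> n - Q n" for n
  proof -
    have "\<Phi> (Suc n) = (\<Sum>z\<in>V. (\<Sum>w\<in>V. a n w * pmf (srw_step E w) z) * g z)"
      unfolding \<Phi>_def by (intro sum.cong refl) (metis a_Suc g0 mult_zero_right)
    also have "\<dots> = (\<Sum>w\<in>V. a n w * (\<Sum>z\<in>V. pmf (srw_step E w) z * g z))"
      unfolding sum_distrib_left sum_distrib_right by (subst sum.swap) (simp add: mult_ac)
    also have "\<dots> = (\<Sum>w\<in>V. a n w * (g w - 1))"
    proof (intro sum.cong refl)
      fix w assume "w \<in> V"
      then show "a n w * (\<Sum>z\<in>V. pmf (srw_step E w) z * g z) = a n w * (g w - 1)"
        using g[of w] by (cases "w = y") (auto simp: a_y)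
    qed
    also have "\<dots> = \<Phi> n - Q n"
      by (simp add: \<Phi>_def Q_def algebra_simps sum_subtractf)
    finally show ?thesis .
  qed
  have sumQ: "(\<Sum>n<m. Q n) = g x - \<Phi> m" for m
    by (induction m) (auto simp: \<Phi>_0 \<Phi>_Suc)
  define G where "G = Max ((\<lambda>w. \<bar>g w\<bar>) ` V)"
  have \<Phi>_bound: "\<bar>\<Phi> n\<bar> \<le> G * Q n" for n
  proof -
    have "\<bar>\<Phi> n\<bar> \<le> (\<Sum>w\<in>V. \<bar>a n w * g w\<bar>)" unfolding \<Phi>_def by (rule sum_abs)
    also have "\<dots> \<le> (\<Sum>w\<in>V. G * a n w)"
    proof (rule sum_mono)
      fix w assume "w \<in> V"
      then have "\<bar>g w\<bar> \<le> G" using V(1) by (simp add: G_def)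
      then show "\<bar>a n w * g w\<bar> \<le> G * a n w"
        using a_nonneg[of n w] by (simp add: abs_mult mult.commute[of G] mult_left_mono)
    qed
    finally show ?thesis by (simp add: Q_def sum_distrib_left)
  qed
  have prob_T: "emeasure (srw E x) {\<omega> \<in> space (srw E x). enat n < hitting_time y \<omega>} = ennreal (Q n)" for n
  proof -
    have "{\<omega> \<in> space (srw E x). enat n < hitting_time y \<omega>} = (\<Union>w. A n w)"
      by (auto simp: less_hitting_time_iff A_def)
    also have "emeasure (srw E x) \<dots> = (\<integral>\<^sup>+w. emeasure (srw E x) (A n w) \<partial>count_space UNIV)"
    proof (rule emeasure_UN_countable)
      show "disjoint_family (A n)"
        by (auto simp: disjoint_family_on_def A_def)
    qed auto
    also have "\<dots> = (\<Sum>w\<in>V. emeasure (srw E x) (A n w))"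
      by (rule nn_integral_count_space') (auto simp: V A_out)
    finally show ?thesis
      by (simp add: Q_def a_def emeasure_eq_measure)
  qed
  have "Q n \<le> 1" for n
    using prob_T[of n] emeasure_le_1[of "{\<omega> \<in> space (srw E x). enat n < hitting_time y \<omega>}"] by simp
  have G_nonneg: "G \<ge> 0"
    using V by (auto simp: G_def intro!: Max_ge_iff[THEN iffD2])
  have "(\<Sum>n<m. Q n) \<le> g x + G" for m
    using sumQ[of m] \<Phi>_bound[of m] mult_left_le[OF \<open>Q m \<le> 1\<close> G_nonneg] by linarith
  then have "summable Q"
    by (intro summableI_nonneg_bounded[where x = "g x + G"] Q_nonneg)
  then have "(\<lambda>n. G * Q n) \<longlonglongrightarrow> 0"
    by (intro tendsto_mult_right_zero summable_LIMSEQ_zero)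
  then have "\<Phi> \<longlonglongrightarrow> 0"
    by (rule Lim_null_comparison[rotated]) (simp add: \<Phi>_bound)
  then have "(\<lambda>m. \<Sum>n<m. Q n) \<longlonglongrightarrow> g x - 0"
    unfolding sumQ by (intro tendsto_intros)
  then have "Q sums g x"
    by (simp add: sums_def)
  have "avg_hitting_time E x y = (\<Sum>n. ennreal (Q n))"
    unfolding avg_hitting_time_def by (subst nn_integral_enat_function) (simp_all only: measurable_hitting_time_count_space prob_T)
  also have "\<dots> = ennreal (g x)"
    using \<open>Q sums g x\<close> by (rule suminf_ennreal_eq[OF Q_nonneg])
  finally show ?thesis .
qed

section \<open>The root rho and the periodic Green function\<close>

lemma rho:
  assumes "N \<ge> 7"
  shows rho_plus_inverse: "rho N + inverse (rho N) = tau N" and norm_rho: "norm (rho N) < 1"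
  using theI'[OF rho_unique[OF assms]] by (auto simp: rho_def)

lemma tau_sqr: "N \<ge> 7 \<Longrightarrow> tau N ^ 2 + tau N = 6 - of_nat N"
  by (simp add: tau_def complex_eq_iff power2_eq_square field_simps)

lemma rho_nonzero: "N \<ge> 7 \<Longrightarrow> rho N \<noteq> 0"
  using rho_plus_inverse[of N] by (auto simp: tau_def complex_eq_iff)

lemma rho_power_neq_1: "N \<ge> 7 \<Longrightarrow> n > 0 \<Longrightarrow> rho N ^ n \<noteq> 1"
  using norm_rho[of N] power_Suc_less_one[of "norm (rho N)" "n - 1"]
  by (metis One_nat_def Suc_pred norm_ge_zero norm_one norm_power power_less_one_iff less_irrefl neq0_conv)

lemma dd_nonzero: "N \<ge> 7 \<Longrightarrow> dd N \<noteq> 0"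
  using rho_power_neq_1[of N 2] rho_nonzero[of N]
  by (auto simp: dd_def field_simps power2_eq_square)

text \<open>The fundamental solution of \<open>u (k + 1) + u (k - 1) - \<tau> u k = \<delta> k\<close> on the residues mod \<open>N\<close>.\<close>

definition green :: "nat \<Rightarrow> int \<Rightarrow> complex" where
  "green N k = (rho N ^ nat (k mod int N) + rho N ^ (N - nat (k mod int N))) / (dd N * (1 - rho N ^ N))"

text \<open>The numerator is symmetric under exchanging \<open>r\<close> and \<open>N - r\<close>,
  so the representative \<open>N\<close> of the class of 0 serves as well as 0 itself. Stepping up
  from \<open>N - 1\<close> therefore needs no separate case.\<close>

lemma green_eq:
  assumes "r \<le> N" and "k mod int N = int r mod int N"
  shows "green N k = (rho N ^ r + rho N ^ (N - r)) / (dd N * (1 - rho N ^ N))"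
proof (cases "r = N")
  case False
  then have "nat (k mod int N) = r"
    using assms by simp
  then show ?thesis
    by (simp add: green_def)
qed (use assms in \<open>simp add: green_def add.commute\<close>)

text \<open>Between consecutive multiples of \<open>N\<close> both \<open>rho N ^ r\<close> and
  \<open>rho N ^ (N - r)\<close> solve the homogeneous recurrence. At a multiple of \<open>N\<close>
  the two branches meet in a kink, and the denominator of \<open>green\<close> normalises its size
  to 1.\<close>

lemma green_rec:
  assumes "N \<ge> 7"
  shows "green N (k + 1) + green N (k - 1) = tau N * green N k + of_bool (int N dvd k)"
proof -
  define \<rho> where "\<rho> = rho N"
  define D where "D = dd N * (1 - \<rho> ^ N)"
  define r where "r = nat (k mod int N)"
  have \<rho>: "\<rho> \<noteq> 0" "D \<noteq> 0"
    using rho_nonzero dd_nonzero rho_power_neq_1[of N N] assms by (auto simp: D_def \<rho>_def)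
  have tau: "tau N = \<rho> + inverse \<rho>"
    using rho_plus_inverse[OF assms] by (simp add: \<rho>_def)
  have r: "r < N" "k mod int N = int r"
    using assms by (auto simp: r_def nat_less_iff)
  have k1: "(k + 1) mod int N = int (r + 1) mod int N"
    using r(2) by (metis mod_add_left_eq of_nat_Suc add.commute Suc_eq_plus1)
  have g: "green N k = (\<rho> ^ r + \<rho> ^ (N - r)) / D"
    "green N (k + 1) = (\<rho> ^ (r + 1) + \<rho> ^ (N - (r + 1))) / D"
    using green_eq[of r N k] green_eq[of "r + 1" N "k + 1"] r k1 by (simp_all add: \<rho>_def D_def)
  show ?thesis
  proof (cases "r = 0")
    case True
    then have dvd: "int N dvd k" using r by auto
    have "(k - 1) mod int N = int (N - 1) mod int N"
      using dvd assms by (auto simp: of_nat_diff elim!: dvdE) (simp add: mod_eq_dvd_iff)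
    then have "green N (k - 1) = (\<rho> ^ (N - 1) + \<rho> ^ (N - (N - 1))) / D"
      unfolding \<rho>_def D_def by (intro green_eq) auto
    also have "N - (N - 1) = 1" using assms by simp
    finally have g': "green N (k - 1) = (\<rho> ^ (N - 1) + \<rho>) / D" by simp
    have \<rho>N: "\<rho> ^ N = \<rho> * \<rho> ^ (N - 1)"
      using assms by (simp flip: power_Suc)
    have "D = (\<rho> - inverse \<rho>) * (1 - \<rho> * \<rho> ^ (N - 1))"
      by (simp add: D_def dd_def \<rho>_def[symmetric] \<rho>N)
    \<comment> \<open>By symmetry both neighbours of 0 carry the value
      \<open>(\<rho> + \<rho> ^ (N - 1)) / D\<close>; this identity shows that the excess of their
      sum over \<open>tau N * green N k\<close> is \<open>D / D\<close>.\<close>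
    then have D: "2 * (\<rho> + \<rho> ^ (N - 1)) = (\<rho> + inverse \<rho>) * (1 + \<rho> ^ N) + D"
      using \<rho>(1) by (simp add: \<rho>N field_simps)
    have "green N (k + 1) + green N (k - 1) = 2 * (\<rho> + \<rho> ^ (N - 1)) / D"
      unfolding g g' by (simp add: True add_divide_distrib)
    also have "\<dots> = (\<rho> + inverse \<rho>) * (1 + \<rho> ^ N) / D + D / D"
      unfolding D by (rule add_divide_distrib)
    also have "\<dots> = tau N * green N k + 1"
      unfolding tau g using \<rho>(2) by (simp add: True)
    finally show ?thesis
      using dvd by simp
  next
    case False
    have ndvd: "\<not> int N dvd k" using False r by (auto simp: dvd_eq_mod_eq_0)
    have "(k - 1) mod int N = int (r - 1) mod int N"
      using False r(2) by (metis mod_diff_left_eq of_nat_1 of_nat_diff Suc_leI neq0_conv One_nat_def)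
    then have g': "green N (k - 1) = (\<rho> ^ (r - 1) + \<rho> ^ (N - (r - 1))) / D"
      unfolding \<rho>_def D_def using r by (intro green_eq) auto
    \<comment> \<open>Naming the predecessors of \<open>r\<close> and \<open>N - r\<close> removes
      the truncated subtractions from all exponents.\<close>
    obtain a b where "r = Suc a" "N - r = Suc b" "N - (r - 1) = Suc (Suc b)" "N - (r + 1) = b"
      using False r by (metis Suc_diff_Suc Suc_eq_plus1 diff_Suc_1 not0_implies_Suc zero_less_diff diff_Suc_Suc Suc_diff_le less_Suc_eq_le less_imp_le)
    then show ?thesis
      using \<rho> ndvd unfolding g g' tau by (simp add: field_simps)
  qed
qed

text \<open>Let L be the sum of the two unit shifts. The shifts by 1 and 2 in both directions add up
  to L^2 + L - 2, and two uses of L u = tau u + delta turn this into (tau^2 + tau - 2) u + (tau + 1)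
  delta + L delta. Here tau^2 + tau - 2 = 4 - N is real, so taking imaginary parts acts on u alone.
  The source L delta at the neighbours is real and disappears, leaving only Im tau at the
  origin.\<close>

lemma Im_green_rec:
  assumes "N \<ge> 7"
  shows "(real N - 5) * Im (green N k) + (\<Sum>j\<in>{-2..2}. Im (green N (k + j))) =
    sqrt (4 * real N - 25) / 2 * of_bool (int N dvd k)"
proof -
  define \<delta> :: "int \<Rightarrow> complex" where "\<delta> k = of_bool (int N dvd k)" for k
  have rec: "green N (k + 1) + green N (k - 1) = tau N * green N k + \<delta> k" for k
    using green_rec[OF assms] by (simp add: \<delta>_def)
  have a: "green N (k + 2) = tau N * green N (k + 1) + \<delta> (k + 1) - green N k"
    using rec[of "k + 1"] by (simp add: eq_diff_eq add.commute)
  have b: "green N (k - 2) = tau N * green N (k - 1) + \<delta> (k - 1) - green N k"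
    using rec[of "k - 1"] by (simp add: eq_diff_eq add.commute)
  have "green N (k + 2) + green N (k - 2) =
      tau N * (green N (k + 1) + green N (k - 1)) + \<delta> (k + 1) + \<delta> (k - 1) - 2 * green N k"
    unfolding a b by (simp add: algebra_simps)
  then have "(green N (k + 2) + green N (k - 2)) + (green N (k + 1) + green N (k - 1)) =
      (tau N ^ 2 + tau N - 2) * green N k + (tau N + 1) * \<delta> k + \<delta> (k + 1) + \<delta> (k - 1)"
    unfolding rec by (simp add: algebra_simps power2_eq_square)
  then have "Im ((green N (k + 2) + green N (k - 2)) + (green N (k + 1) + green N (k - 1))) =
      Im ((4 - of_nat N) * green N k + (tau N + 1) * \<delta> k + \<delta> (k + 1) + \<delta> (k - 1))"
    unfolding tau_sqr[OF assms] by simp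
  also have "\<dots> = (4 - real N) * Im (green N k) + sqrt (4 * real N - 25) / 2 * of_bool (int N dvd k)"
    by (simp add: \<delta>_def tau_def)
  finally have *: "Im ((green N (k + 2) + green N (k - 2)) + (green N (k + 1) + green N (k - 1))) = \<dots>" .
  have "{-2..2} = {-2, -1, 0, 1, 2 :: int}" by auto
  then show ?thesis
    using * by (simp add: algebra_simps)
qed

section \<open>First-step equations on the circulant graph\<close>

lemma mod_nat_shift:
  assumes "v < N" "\<bar>j\<bar> < int N"
  shows "(int v + j) mod int N =
    (if int v + j < 0 then int v + j + int N else if int v + j < int N then int v + j else int v + j - int N)"
proof -
  have up: "(int v + j) mod int N = (int v + j + int N) mod int N"
    and down: "(int v + j) mod int N = (int v + j - int N) mod int N" by simp_all
  consider "int v + j < 0" | "0 \<le> int v + j" "int v + j < int N" | "int v + j \<ge> int N"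
    by linarith
  then show ?thesis
  proof cases
    case 1
    then show ?thesis using assms by (subst up) (subst mod_pos_pos_trivial; simp)
  next
    case 2
    then show ?thesis by simp
  next
    case 3
    then show ?thesis using assms by (subst down) (subst mod_pos_pos_trivial; simp)
  qed
qed

lemma not_G2_eq:
  assumes "N \<ge> 7" "v < N"
  shows "{w. w < N \<and> \<not> G2 N v w} = (\<lambda>j. nat ((int v + j) mod int N)) ` {-2..2}"
proof (intro equalityI subsetI)
  fix w assume w: "w \<in> {w. w < N \<and> \<not> G2 N v w}"
  \<comment> \<open>The signed offset from \<open>v\<close> to \<open>w\<close> along the shorter
    arc: a difference exceeding 2 in absolute value must wrap around 0 and is corrected by
    \<open>N\<close>.\<close>
  define j where "j = (if \<bar>int w - int v\<bar> \<le> 2 then int w - int v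
    else if w < v then int w - int v + int N else int w - int v - int N)"
  have j: "j \<in> {-2..2}"
    using w assms by (auto simp: j_def G2_def circ_dist_def)
  moreover have "w = nat ((int v + j) mod int N)"
    using w assms j by (subst mod_nat_shift) (auto simp: j_def)
  ultimately show "w \<in> (\<lambda>j. nat ((int v + j) mod int N)) ` {-2..2}" by blast
next
  fix w assume "w \<in> (\<lambda>j. nat ((int v + j) mod int N)) ` {-2..2}"
  then obtain j where j: "j \<in> {-2..2}" "w = nat ((int v + j) mod int N)" by blast
  have "\<bar>j\<bar> < int N"
    using j(1) assms by auto
  have "int w = (int v + j) mod int N"
    using j(2) assms by simp
  then show "w \<in> {w. w < N \<and> \<not> G2 N v w}"
    unfolding mod_nat_shift[OF assms(2) \<open>\<bar>j\<bar> < int N\<close>]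
    using j(1) assms by (auto simp: G2_def circ_dist_def split: if_splits)
qed

lemma inj_on_not_G2:
  assumes "N \<ge> 7" "v < N"
  shows "inj_on (\<lambda>j. nat ((int v + j) mod int N)) {-2..2}"
proof (rule inj_onI)
  fix i j :: int
  assume ij: "i \<in> {-2..2}" "j \<in> {-2..2}" "nat ((int v + i) mod int N) = nat ((int v + j) mod int N)"
  then have "(int v + i) mod int N = (int v + j) mod int N"
    using assms by (subst (asm) eq_nat_nat_iff) auto
  then show "i = j"
    using ij assms by (auto simp: mod_nat_shift split: if_splits)
qed

text \<open>Passing to the complement replaces the \<open>N - 5\<close> neighbours by a full period
  minus the five vertices at offsets -2 to 2. This is how a recurrence with five consecutive points
  arises.\<close>

lemma sum_G2:
  fixes f :: "nat \<Rightarrow> real"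
  assumes "N \<ge> 7" "v < N"
  shows "(\<Sum>w | G2 N v w. f w) = (\<Sum>w<N. f w) - (\<Sum>j\<in>{-2..2}. f (nat ((int v + j) mod int N)))"
proof -
  have "{..<N} = {w. G2 N v w} \<union> {w. w < N \<and> \<not> G2 N v w}"
    by (auto simp: G2_def)
  then have "(\<Sum>w<N. f w) = sum f ({w. G2 N v w} \<union> {w. w < N \<and> \<not> G2 N v w})"
    by (rule arg_cong)
  also have "\<dots> = (\<Sum>w | G2 N v w. f w) + (\<Sum>w | w < N \<and> \<not> G2 N v w. f w)"
    by (rule sum.union_disjoint) (simp_all add: G2_neighbours[OF assms] disjoint_iff)
  finally have "(\<Sum>w<N. f w) = \<dots>" .
  then show ?thesis
    unfolding not_G2_eq[OF assms] sum.reindex[OF inj_on_not_G2[OF assms]] by (simp add: o_def)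
qed

lemma sum_periodic_shift:
  fixes f :: "int \<Rightarrow> real"
  assumes "\<And>k. f (k mod int N) = f k" "N > 0"
  shows "(\<Sum>w<N. f (int w + j)) = (\<Sum>w<N. f (int w))"
proof (rule sum.reindex_bij_witness[where i = "\<lambda>w. nat ((int w - j) mod int N)"
      and j = "\<lambda>w. nat ((int w + j) mod int N)"])
  fix w assume "w \<in> {..<N}"
  then show "nat ((int (nat ((int w + j) mod int N)) - j) mod int N) = w"
    "nat ((int (nat ((int w - j) mod int N)) + j) mod int N) = w"
    "nat ((int w + j) mod int N) \<in> {..<N}" "nat ((int w - j) mod int N) \<in> {..<N}"
    "f (int (nat ((int w + j) mod int N))) = f (int w + j)"
    using assms by (simp_all add: mod_simps nat_less_iff)
qed

text \<open>Away from the target, the first-step equation says that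
  \<open>(real N - 5) * f k\<close> plus the five-point sum equals \<open>N - 5\<close> plus the sum
  \<open>S\<close> of \<open>f\<close> over a period. Summing the assumed equation over a period
  gives \<open>S = c - (real N - 5)\<close>, so \<open>c\<close> has the right value automatically.
  The source strength \<open>N * (N - 5)\<close> encodes the mean return time \<open>N\<close> to
  the target.\<close>

lemma avg_hitting_time_G2:
  fixes f :: "int \<Rightarrow> real"
  assumes N: "N \<ge> 7" and xy: "x < N" "y < N"
    and per: "\<And>k. f (k mod int N) = f k" and f0: "f 0 = 0"
    and f: "\<And>k. (real N - 5) * f k + (\<Sum>j\<in>{-2..2}. f (k + j)) =
      c - real N * (real N - 5) * of_bool (int N dvd k)"
  shows "avg_hitting_time (G2 N) x y = ennreal (f (int x - int y))"
proof (rule avg_hitting_time_eqI[where V = "{..<N}"])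
  define g where "g v = f (int v - int y)" for v
  define S where "S = (\<Sum>w<N. f (int w))"
  have shift: "(\<Sum>w<N. f (int w + j)) = S" for j
    unfolding S_def using N by (intro sum_periodic_shift per) auto
  have "(\<Sum>w<N. (real N - 5) * f (int w) + (\<Sum>j\<in>{-2..2}. f (int w + j))) =
      (\<Sum>w<N. c - real N * (real N - 5) * of_bool (int N dvd int w))"
    by (simp only: f)
  also have "(\<Sum>w<N. of_bool (int N dvd int w)) = (1 :: real)"
  proof -
    have "(\<Sum>w<N. of_bool (int N dvd int w)) = (\<Sum>w<N. of_bool (w = 0) :: real)"
      by (intro sum.cong refl) (auto dest: nat_dvd_not_less)
    also have "\<dots> = 1" using N by (simp add: of_bool_def)
    finally show ?thesis .
  qed
  then have "(\<Sum>w<N. c - real N * (real N - 5) * of_bool (int N dvd int w)) =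
      real N * c - real N * (real N - 5)"
    by (simp add: sum_subtractf sum_distrib_left[symmetric])
  also have "(\<Sum>w<N. (real N - 5) * f (int w) + (\<Sum>j\<in>{-2..2}. f (int w + j))) =
      (real N - 5) * S + (\<Sum>j\<in>{-2..2}. \<Sum>w<N. f (int w + j))"
    unfolding S_def sum.distrib sum_distrib_left by (subst sum.swap) simp
  also have "\<dots> = real N * S"
    unfolding shift by (simp add: algebra_simps)
  finally have "real N * S = real N * (c - (real N - 5))"
    by (simp add: algebra_simps)
  then have S: "S = c - (real N - 5)"
    using N by simp
  show "f (int y - int y) = 0" by (simp add: f0)
  fix v assume "v \<in> {..<N}"
  then have v: "v < N" by simp
  note nb = G2_neighbours[OF N v]
  show "set_pmf (srw_step (G2 N) v) \<subseteq> {..<N}"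
    using nb by (auto simp: srw_step_def set_pmf_of_set) (auto simp: G2_def)
  assume "v \<noteq> y"
  then have ndvd: "\<not> int N dvd (int v - int y)"
    using v xy by (auto dest!: dvd_imp_le_int simp: mod_eq_dvd_iff[symmetric])
  have card: "real (card {w. G2 N v w}) = real N - 5"
    using sum_G2[OF N v, of "\<lambda>_. 1"] by simp
  \<comment> \<open>Periodicity of \<open>f\<close> allows the reduction modulo \<open>N\<close> to
    be dropped, although \<open>g\<close> itself is only meant on representatives.\<close>
  have shift_g: "g (nat ((int v + j) mod int N)) = f (int v - int y + j)" for j
    using N per[of "(int v + j) mod int N - int y"] per[of "int v - int y + j"]
    by (simp add: g_def mod_simps algebra_simps)
  have "(\<Sum>w | G2 N v w. g w) = (\<Sum>w<N. g w) - (\<Sum>j\<in>{-2..2}. g (nat ((int v + j) mod int N)))"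
    by (rule sum_G2[OF N v])
  also have "(\<Sum>w<N. g w) = S"
    using shift[of "- int y"] by (simp add: g_def)
  also have "S - (\<Sum>j\<in>{-2..2}. g (nat ((int v + j) mod int N))) = (real N - 5) * (g v - 1)"
    unfolding shift_g using f[of "int v - int y"] ndvd S by (simp add: g_def algebra_simps)
  finally have *: "(\<Sum>w | G2 N v w. g w) = (real N - 5) * (g v - 1)" .
  have pmf: "pmf (srw_step (G2 N) v) w = indicator {w. G2 N v w} w / (real N - 5)" for w
    using nb by (simp add: srw_step_def card)
  have sub: "{w. G2 N v w} \<subseteq> {..<N}"
    by (auto simp: G2_def)
  have "(\<Sum>w<N. pmf (srw_step (G2 N) v) w * g w) = (\<Sum>w | G2 N v w. g w / (real N - 5))"
    by (rule sum.mono_neutral_cong_right) (simp_all add: sub pmf)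
  also have "\<dots> = g v - 1"
    using * N by (simp add: sum_divide_distrib[symmetric])
  finally show "f (int v - int y) = 1 + (\<Sum>w<N. pmf (srw_step (G2 N) v) w * f (int w - int y))"
    by (simp add: g_def)
qed (use xy in auto)

section \<open>The closed form\<close>

lemma CC_eq: "CC N = (1 + rho N ^ N) / (dd N * (1 - rho N ^ N))" if "N \<ge> 7"
proof -
  have "P2 N N + dd N * B2 N N = 2 * rho N ^ N"
    using dd_nonzero[OF that] by (simp add: P2_def B2_def)
  then have "CC N = (2 * (1 + rho N ^ N)) / (2 * (dd N * (1 - rho N ^ N)))"
    by (simp add: CC_def add.assoc diff_diff_eq algebra_simps)
  then show ?thesis
    by (subst (asm) mult_divide_mult_cancel_left) auto
qed

text \<open>\<open>CC N\<close> equals \<open>green N 0\<close>, so the right-hand side vanishes at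
  \<open>l = 0\<close>. Over the common denominator \<open>2 * dd N * (1 - q)\<close>, the
  coefficients of \<open>rho N ^ l\<close> in the subtracted terms are 1 + q and 1 - q, with sum 2;
  those of the inverse power are 1 + q and -(1 - q), with sum 2q. These are the two branches of the
  Green function.\<close>

lemma CC_minus_eq_green:
  assumes "N \<ge> 7" "l \<le> N"
  shows "CC N - CC N / 2 * P2 N l - 1 / 2 * B2 N l = CC N - green N (- int l)"
proof -
  define q where "q = rho N ^ N"
  have nz: "rho N \<noteq> 0" "dd N \<noteq> 0" "1 - q \<noteq> 0"
    using assms rho_nonzero dd_nonzero rho_power_neq_1[of N N] by (auto simp: q_def)
  have "green N (- int l) = (rho N ^ (N - l) + rho N ^ l) / (dd N * (1 - q))"
    using assms unfolding q_def
    by (subst green_eq[of "N - l"]) (auto simp: of_nat_diff mod_eq_dvd_iff)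
  also have "rho N ^ (N - l) = q * inverse (rho N) ^ l"
    using nz assms by (simp add: q_def power_diff field_simps)
  finally have green: "green N (- int l) = (q * inverse (rho N) ^ l + rho N ^ l) / (dd N * (1 - q))" .
  show ?thesis
    using nz unfolding green CC_eq[OF assms(1)] P2_def B2_def q_def[symmetric]
    by (simp add: divide_simps) (simp add: algebra_simps)
qed

theorem corollary4p4:
  fixes N l :: nat
  assumes "odd N" and "N \<ge> 7"
    and "1 \<le> l" and "real l \<le> real N / 2 - 1"
  shows "avg_hitting_time (G2 N) 0 l =
    ennreal (2 * real N * (real N - 5) / sqrt (4 * real N - 25) *
      Im (CC N - CC N / 2 * P2 N l - 1 / 2 * B2 N l))"
proof -
  define s where "s = sqrt (4 * real N - 25)"
  \<comment> \<open>Chosen so that \<open>K * s / 2 = N * (N - 5)\<close>: it rescales the source in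
    \<open>Im_green_rec\<close> to the one required by \<open>avg_hitting_time_G2\<close>.\<close>
  define K where "K = 2 * real N * (real N - 5) / s"
  define f where "f k = K * (Im (CC N) - Im (green N k))" for k
  have s: "s > 0" using assms by (simp add: s_def)
  have "avg_hitting_time (G2 N) 0 l = ennreal (f (int 0 - int l))"
  \<comment> \<open>The constant part of \<open>f\<close> is counted with weight
    \<open>N - 5\<close> and five more times in the sum, that is \<open>N\<close> times.\<close>
  proof (rule avg_hitting_time_G2[where c = "real N * K * Im (CC N)"])
    show "f (k mod int N) = f k" for k
      by (simp add: f_def green_def)
    show "f 0 = 0"
      using assms CC_eq by (simp add: f_def green_def)
    fix k
    have "(real N - 5) * f k + (\<Sum>j\<in>{-2..2}. f (k + j)) = real N * K * Im (CC N) -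
        K * ((real N - 5) * Im (green N k) + (\<Sum>j\<in>{-2..2}. Im (green N (k + j))))"
      by (simp add: f_def sum_distrib_left[symmetric] sum_subtractf algebra_simps)
    also have "\<dots> = real N * K * Im (CC N) - K * (s / 2 * of_bool (int N dvd k))"
      unfolding s_def by (subst Im_green_rec) (use assms in auto)
    also have "K * (s / 2 * of_bool (int N dvd k)) = real N * (real N - 5) * of_bool (int N dvd k)"
      using s by (simp add: K_def)
    finally show "(real N - 5) * f k + (\<Sum>j\<in>{-2..2}. f (k + j)) =
        real N * K * Im (CC N) - real N * (real N - 5) * of_bool (int N dvd k)" .
  qed (use assms in auto)
  moreover have "l \<le> N" using assms by linarith
  ultimately show ?thesis
    unfolding CC_minus_eq_green[OF assms(2) \<open>l \<le> N\<close>] by (simp add: f_def K_def s_def)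
qed

end
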